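(* Let $p\ge1$ and $F(x)=\tfrac15(\sin x_1,\dots,\sin x_p)$ for $x=(x_1,\dots,x_p)\in\mathbb{R}^p$. Then the set $A=\{k+F(k):k\in\mathbb{Z}^p\}\subset\mathbb{R}^p$ is an almost periodic discrete set that has no period $\tau\in\mathbb{R}^p\setminus\{0\}$. Consequently, $A$ is not of the form $L'+E$ with $L'$ a discrete lattice in $\mathbb{R}^p$ and $E\subset\mathbb{R}^p$ a finite set.
   Context: A continuous function $f$ on $\mathbb{R}^p$ is almost periodic if for every $\varepsilon>0$ the set $\{\tau\in\mathbb{R}^p:\sup_{x\in\mathbb{R}^p}|f(x+\tau)-f(x)|<\varepsilon\}$ is relatively dense in $\mathbb{R}^p$, i.e. there is $R=R(\varepsilon)<\infty$ such that every ball of radius $R$ contains an element of this set. A Borel measure $\mu$ on $\mathbb{R}^p$ is almost periodic (in the weak sense) if for every continuous compactly supported function $\varphi$ on $\mathbb{R}^p$ the function $x\mapsto\int\varphi(x+t)\,d\mu(t)$ is almost periodic on $\mathbb{R}^p$. A discrete (locally finite) set $A\subset\mathbb{R}^p$ is almost periodic if the measure $\sum_{x\in A}\delta_x$ is almost periodic, where $\delta_x$ is the unit mass at $x$. A vector $\tau$ is a period of $A$ if $A+\tau=A$. A discrete lattice in $\mathbb{R}^p$ is a set $\{k\Gamma:k\in\mathbb{Z}^p\}$ with $\Gamma$ an invertible real $p\times p$ matrix (full rank lattice). $L'+E$ denotes the set $\{l+e: l\in L', e\in E\}$. *)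

theory Defs
  imports "HOL-Probability.Giry_Monad"
begin

definition relatively_dense :: "'a::metric_space set \<Rightarrow> bool" where
  "relatively_dense T \<longleftrightarrow> (\<exists>R::real. \<forall>x. \<exists>\<tau>\<in>T. \<tau> \<in> ball x R)"

(* The supremum is taken in the extended reals: the real supremum of an unbounded
   set would be an unspecified number. *)
definition almost_periodic_fun :: "('a::euclidean_space \<Rightarrow> 'b::real_normed_vector) \<Rightarrow> bool" where
  "almost_periodic_fun f \<longleftrightarrow>
     continuous_on UNIV f \<and>
     (\<forall>\<epsilon>::real. \<epsilon> > 0 \<longrightarrow>
        relatively_dense {\<tau>. (SUP x. ereal (norm (f (x + \<tau>) - f x))) < ereal \<epsilon>})"

(* Finiteness on compact sets makes the Bochner integral below a genuine one for every
   test function, rather than the default value 0 of a non-integrable function. *)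
definition almost_periodic_measure :: "'a::euclidean_space measure \<Rightarrow> bool" where
  "almost_periodic_measure \<mu> \<longleftrightarrow>
     sets \<mu> = sets borel \<and>
     (\<forall>K. compact K \<longrightarrow> emeasure \<mu> K < \<infinity>) \<and>
     (\<forall>\<phi>::'a \<Rightarrow> complex.
        continuous_on UNIV \<phi> \<longrightarrow> compact (closure {x. \<phi> x \<noteq> 0}) \<longrightarrow>
        almost_periodic_fun (\<lambda>x. \<integral>t. \<phi> (x + t) \<partial>\<mu>))"

(* The sum of the unit masses at the points of A, as the image on the Borel sets of the
   counting measure of A; see emeasure_dirac_comb. *)
definition dirac_comb :: "'a::topological_space set \<Rightarrow> 'a measure" where
  "dirac_comb A = distr (count_space A) borel (\<lambda>x. x)"

lemma emeasure_dirac_comb: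
  assumes "B \<in> sets borel"
  shows "emeasure (dirac_comb A) B = (\<integral>\<^sup>+x. emeasure (return borel x) B \<partial>count_space A)"
proof -
  have "emeasure (dirac_comb A) B = emeasure (count_space A) (B \<inter> A)"
    unfolding dirac_comb_def using assms by (subst emeasure_distr) auto
  also have "\<dots> = (\<integral>\<^sup>+x. indicator (B \<inter> A) x \<partial>count_space A)"
    by (subst nn_integral_indicator) auto
  also have "\<dots> = (\<integral>\<^sup>+x. emeasure (return borel x) B \<partial>count_space A)"
    using assms by (intro nn_integral_cong) (auto simp: indicator_def)
  finally show ?thesis .
qed

definition discrete_set :: "'a::metric_space set \<Rightarrow> bool" where
  "discrete_set A \<longleftrightarrow> (\<forall>K. compact K \<longrightarrow> finite (A \<inter> K))"

definition almost_periodic_set :: "'a::euclidean_space set \<Rightarrow> bool" where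
  "almost_periodic_set A \<longleftrightarrow> discrete_set A \<and> almost_periodic_measure (dirac_comb A)"

definition is_period :: "'a::ab_group_add set \<Rightarrow> 'a \<Rightarrow> bool" where
  "is_period A \<tau> \<longleftrightarrow> (\<lambda>x. x + \<tau>) ` A = A"

definition integer_vectors :: "(real ^ 'n) set" where
  "integer_vectors = {k. \<forall>i. k $ i \<in> \<int>}"

definition discrete_lattice :: "(real ^ 'n) set \<Rightarrow> bool" where
  "discrete_lattice L \<longleftrightarrow>
     (\<exists>\<Gamma> :: real ^ 'n ^ 'n. invertible \<Gamma> \<and> L = {k v* \<Gamma> | k. k \<in> integer_vectors})"

end

(* An integer vector \<tau> whose entries are all close to 2 pi Z shifts F by little on Z^p, so
   reindexing the lattice sum of a test function by \<tau> changes it by little: only boundedly many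
   terms are nonzero, and each changes by at most the modulus of continuity. Such \<tau> are relatively
   dense because the points cis n, n an integer, are totally bounded.
   A period moves, in each coordinate, n + sin n / 5 to n' + sin n' / 5 with n' - n = d constant,
   so sin (n + d) - sin n is constant; summing along multiples of d shows that the constant is 0,
   and then sin d = 0 with d an integer forces d = 0 since pi is irrational. *)
theory Submission
  imports Defs "HOL-Computational_Algebra.Polynomial"
begin

section \<open>Higher derivatives of polynomials and the irrationality of pi\<close>

lemma poly_higher_pderiv_0:
  fixes p :: "'a::{idom,semiring_char_0} poly"
  shows "poly ((pderiv ^^ j) p) 0 = fact j * coeff p j"
  by (simp add: poly_0_coeff_0 coeff_higher_pderiv pochhammer_fact)

lemma higher_pderiv_eq_0:
  fixes p :: "'a::{idom,semiring_char_0} poly"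
  assumes "degree p < j"
  shows "(pderiv ^^ j) p = 0"
  using assms by (intro poly_eqI) (simp add: coeff_higher_pderiv coeff_eq_0)

text \<open>The inner function \<open>c - x\<close> has derivative -1, so each differentiation
  contributes one sign. For a polynomial invariant under this reflection, this ties the derivatives
  at \<open>c\<close> to those at 0.\<close>

lemma higher_pderiv_pcompose_reflect:
  fixes p :: "'a::idom poly"
  shows "(pderiv ^^ j) (pcompose p [:c, -1:]) = smult ((-1) ^ j) (pcompose ((pderiv ^^ j) p) [:c, -1:])"
proof (induction j)
  case (Suc j)
  have "pderiv [:c, -1:] = [:-1:]" by (simp add: pderiv_pCons)
  with Suc show ?case
    by (simp add: pderiv_smult pderiv_pcompose)
qed simp

lemma pcompose_power: "pcompose (p ^ n) q = pcompose p q ^ n"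
  by (induction n) (simp_all add: pcompose_mult pcompose_1)

lemma coeff_power_Ints:
  fixes p :: "'a::comm_ring_1 poly"
  assumes "\<And>i. coeff p i \<in> \<int>"
  shows "coeff (p ^ n) i \<in> \<int>"
proof (induction n arbitrary: i)
  case (Suc n)
  then show ?case by (auto simp: coeff_mult assms intro!: Ints_sum Ints_mult)
qed (auto simp: coeff_1)

lemma Ints_fact_div_fact:
  assumes "n \<le> j"
  shows "(fact j :: 'a::field_char_0) / fact n \<in> \<int>"
proof -
  obtain m :: nat where "fact j = fact n * m" using fact_dvd[OF assms, where 'a=nat] by (auto elim: dvdE)
  then have "(fact j :: 'a) = fact n * of_nat m" by (metis of_nat_fact of_nat_mult)
  then show ?thesis by simp
qed

text \<open>
  Niven's proof: if pi = a / b and f(x) = x^n (a - b x)^n / n!, then the alternating sum H of the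
  even derivatives of f takes integer values at 0 and pi, and H' sin - H cos has derivative f sin.
  The mean value theorem replaces the usual integral.
\<close>
theorem pi_irrational: "pi \<notin> \<rat>"
proof
  assume "pi \<in> \<rat>"
  then obtain a b :: nat where "b \<noteq> 0" and "\<bar>pi\<bar> = real a / real b"
    by (rule Rats_abs_nat_div_natE)
  then have ab: "real a = real b * pi" by (simp add: field_simps)
  \<comment> \<open>These are terms of a convergent exponential series. The threshold
    \<open>1 / pi\<close> is chosen so that the mean value increment
    \<open>pi * (poly f z * sin z)\<close> ends up below 1.\<close>
  have "(\<lambda>n. (pi * a) ^ n / fact n) \<longlonglongrightarrow> 0"
    using summable_LIMSEQ_zero[OF summable_exp[of "pi * real a"]] by (simp add: field_simps)
  then have "\<forall>\<^sub>F n in sequentially. (pi * a) ^ n / fact n < 1 / pi"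
    by (rule order_tendstoD) simp
  then obtain n where n: "(pi * a) ^ n / fact n < 1 / pi"
    by (auto simp: eventually_sequentially)
  define q :: "real poly" where "q = [:0, real a, - real b:]"
  define f where "f = smult (1 / fact n) (q ^ n)"
  define D where "D j = (pderiv ^^ j) f" for j
  have D_Suc: "pderiv (D j) = D (Suc j)" for j by (simp add: D_def)
  \<comment> \<open>The value is \<open>fact j / fact n\<close> times an integer coefficient of
    \<open>q ^ n\<close>. For \<open>n \<le> j\<close> the quotient of factorials is an integer; for
    \<open>j < n\<close> the coefficient vanishes because \<open>q ^ n\<close> is divisible by the
    n-th power of x.\<close>
  have D0_Ints: "poly (D j) 0 \<in> \<int>" for j
  proof (cases "n \<le> j")
    case True
    have "coeff (q ^ n) j \<in> \<int>"
      by (rule coeff_power_Ints) (auto simp: q_def coeff_pCons split: nat.split)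
    then have "fact j / fact n * coeff (q ^ n) j \<in> \<int>"
      by (intro Ints_mult Ints_fact_div_fact True)
    then show ?thesis by (simp add: D_def poly_higher_pderiv_0 f_def)
  next
    case False
    have "q = monom 1 1 * [:real a, - real b:]" by (simp add: q_def monom_altdef)
    then have "q ^ n = monom 1 n * [:real a, - real b:] ^ n"
      by (simp only: power_mult_distrib monom_power) simp
    with False show ?thesis by (simp add: D_def poly_higher_pderiv_0 f_def coeff_monom_mult)
  qed
  \<comment> \<open>Since \<open>a = b * pi\<close>, the roots of \<open>q\<close> are 0 and pi,
    which the reflection exchanges.\<close>
  have "pcompose q [:pi, -1:] = q" by (simp add: q_def pcompose_pCons ab algebra_simps)
  then have f_reflect: "pcompose f [:pi, -1:] = f"
    by (simp add: f_def pcompose_smult pcompose_power)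
  have "D j = smult ((-1) ^ j) (pcompose (D j) [:pi, -1:])" for j
    using higher_pderiv_pcompose_reflect[of j f pi] unfolding D_def f_reflect .
  from arg_cong[OF this, of "\<lambda>p. poly p pi"]
  have Dpi: "poly (D j) pi = (-1) ^ j * poly (D j) 0" for j
    by (simp add: poly_pcompose)
  define H where "H = (\<Sum>j\<le>n. smult ((-1) ^ j) (D (2 * j)))"
  have H_Ints: "poly H pi + poly H 0 \<in> \<int>"
    by (auto simp: H_def poly_sum Dpi intro!: Ints_add Ints_sum Ints_mult D0_Ints)
  have "degree f \<le> 2 * n"
  proof -
    have "degree q \<le> 2" by (simp add: q_def)
    then have "degree q * n \<le> 2 * n" by simp
    with degree_power_le[of q n] have "degree (q ^ n) \<le> 2 * n" by (rule order_trans)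
    then show ?thesis by (simp add: f_def)
  qed
  then have "degree f < 2 * Suc n" by simp
  then have D_top: "D (2 * Suc n) = 0"
    unfolding D_def by (rule higher_pderiv_eq_0)
  \<comment> \<open>Two differentiations move each summand of \<open>H\<close> to the next index
    with the opposite sign, so the sum telescopes from \<open>D 0 = f\<close> to a derivative of
    order above the degree, which is 0.\<close>
  have "pderiv (pderiv H) + H = (\<Sum>j\<le>n. smult ((-1) ^ j) (D (2 * j)) - smult ((-1) ^ Suc j) (D (2 * Suc j)))"
    by (simp add: H_def higher_pderiv_sum[of 1, simplified] pderiv_smult D_Suc sum.distrib sum_negf)
  also have "\<dots> = f"
    using sum_telescope[of "\<lambda>j. smult ((-1) ^ j) (D (2 * j))" n]
    by (simp only: D_top) (simp add: D_def)
  finally have HH: "pderiv (pderiv H) + H = f" .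
  define G where "G x = poly (pderiv H) x * sin x - poly H x * cos x" for x
  have "(G has_real_derivative poly f x * sin x) (at x)" for x
    unfolding G_def HH[symmetric] by (auto intro!: derivative_eq_intros simp: algebra_simps)
  then obtain z where z: "0 < z" "z < pi" "G pi - G 0 = (pi - 0) * (poly f z * sin z)"
    using MVT2[of 0 pi G "\<lambda>x. poly f x * sin x"] by auto
  have fz: "poly f z = (z * (a - b * z)) ^ n / fact n"
    by (simp add: f_def q_def poly_power algebra_simps)
  \<comment> \<open>Here \<open>a - b * z = b * (pi - z)\<close>, and \<open>z\<close> lies strictly
    between 0 and pi.\<close>
  have pos: "0 < z * (a - b * z)" using z \<open>b \<noteq> 0\<close> ab by simp
  have "z * (a - b * z) \<le> pi * a" using z pos by (intro mult_mono) (auto simp: zero_less_mult_iff)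
  then have "poly f z \<le> (pi * a) ^ n / fact n"
    unfolding fz using pos by (intro divide_right_mono power_mono) auto
  then have fz1: "poly f z < 1 / pi" using n by simp
  have fz0: "0 < poly f z" unfolding fz using pos by simp
  have sz: "0 < sin z" "sin z \<le> 1" using z sin_gt_zero by auto
  have "poly f z * sin z \<le> poly f z" using fz0 sz by (simp add: mult_left_le)
  with fz1 have "poly f z * sin z < 1 / pi" by simp
  \<comment> \<open>The sine vanishes at both ends and the cosine is 1 and -1 there, so the
    increment of \<open>G\<close> is an integer strictly between 0 and 1.\<close>
  then have "G pi - G 0 < 1" by (simp add: z field_simps)
  moreover have "0 < G pi - G 0" using fz0 sz z by simp
  moreover have "G pi - G 0 = poly H pi + poly H 0" by (simp add: G_def)
  ultimately show False using H_Ints by (auto elim!: Ints_cases)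
qed

section \<open>Integer shifts of the sine\<close>

text \<open>Starting from \<open>sin 0 = 0\<close>, the sine would grow linearly along the multiples
  of \<open>d\<close> unless \<open>c\<close> vanishes. Then \<open>d\<close> is an integer zero of
  the sine, hence an integer multiple of pi, and irrationality leaves only 0.\<close>

lemma sin_int_period_eq_0:
  assumes "\<And>n::int. sin (of_int (n + d)) - sin (of_int n) = (c::real)"
  shows "c = 0" and "d = 0"
proof -
  have *: "sin (of_int (int N * d)) = real N * c" for N
  proof (induction N)
    case (Suc N)
    then show ?case using assms[of "int N * d"] by (simp add: algebra_simps)
  qed simp
  show c: "c = 0"
  proof (rule ccontr)
    assume "c \<noteq> 0"
    then obtain N where "1 < real N * \<bar>c\<bar>" using reals_Archimedean3[of "\<bar>c\<bar>"] by auto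
    then have "1 < \<bar>sin (of_int (int N * d)) :: real\<bar>" unfolding * by (simp add: abs_mult)
    then show False using abs_sin_le_one by (metis not_le)
  qed
  show "d = 0"
  proof (rule ccontr)
    assume "d \<noteq> 0"
    have "sin (of_int d :: real) = 0" using assms[of 0] c by simp
    then obtain k :: int where k: "of_int d = of_int k * pi" by (auto simp: sin_zero_iff_int2)
    with \<open>d \<noteq> 0\<close> have "pi = of_int d / of_int k" by (auto simp: field_simps)
    then show False using pi_irrational by (metis Rats_divide Rats_of_int)
  qed
qed

section \<open>Integer vectors in balls\<close>

lemma finite_integer_vectors_norm_le:
  "finite {k \<in> integer_vectors. norm (k :: real ^ 'n) \<le> R}"
proof -
  define B where "B = {- \<lceil>R\<rceil>..\<lceil>R\<rceil>}"
  have "{k \<in> integer_vectors. norm (k :: real ^ 'n) \<le> R} \<subseteq> (\<lambda>f. \<chi> i. real_of_int (f i)) ` {f. range f \<subseteq> B}"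
  proof clarify
    fix k :: "real ^ 'n" assume k: "k \<in> integer_vectors" "norm k \<le> R"
    have kI: "real_of_int \<lfloor>k $ i\<rfloor> = k $ i" for i
      using k by (auto simp: integer_vectors_def elim!: Ints_cases)
    have "\<bar>k $ i\<bar> \<le> R" for i using component_le_norm_cart[of k i] k by simp
    then have "of_int \<bar>\<lfloor>k $ i\<rfloor>\<bar> \<le> R" for i by (simp add: kI)
    then have "\<bar>\<lfloor>k $ i\<rfloor>\<bar> \<le> \<lceil>R\<rceil>" for i by (meson le_of_int_ceiling of_int_le_iff order_trans)
    then have "\<lfloor>k $ i\<rfloor> \<in> B" for i by (simp add: B_def abs_le_iff minus_le_iff)
    then show "k \<in> (\<lambda>f. \<chi> i. real_of_int (f i)) ` {f. range f \<subseteq> B}"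
      by (intro image_eqI[of _ _ "\<lambda>i. \<lfloor>k $ i\<rfloor>"]) (auto simp: vec_eq_iff kI)
  qed
  moreover have "{f :: 'n \<Rightarrow> int. range f \<subseteq> B} = (UNIV \<rightarrow>\<^sub>E B)" by auto
  then have "finite {f :: 'n \<Rightarrow> int. range f \<subseteq> B}" by (simp add: finite_PiE B_def)
  ultimately show ?thesis by (meson finite_surj)
qed

lemma integer_vectors_add: "k \<in> integer_vectors \<Longrightarrow> l \<in> integer_vectors \<Longrightarrow> k + l \<in> integer_vectors"
  and integer_vectors_diff: "k \<in> integer_vectors \<Longrightarrow> l \<in> integer_vectors \<Longrightarrow> k - l \<in> integer_vectors"
  by (auto simp: integer_vectors_def)

text \<open>The bound is uniform in the centre: translating by the integer vector of the floors of
  \<open>x\<close> carries every such ball into one about 0, whose radius grows by at most the l1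
  norm of the fractional parts.\<close>

lemma integer_vectors_translate_card:
  obtains N where "\<And>x :: real ^ 'n. finite {k \<in> integer_vectors. norm (x + k) \<le> R}"
    and "\<And>x :: real ^ 'n. card {k \<in> integer_vectors. norm (x + k) \<le> R} \<le> N"
proof -
  define B where "B = {k \<in> integer_vectors. norm (k :: real ^ 'n) \<le> R + real CARD('n)}"
  have fB: "finite B" unfolding B_def by (rule finite_integer_vectors_norm_le)
  have "{k \<in> integer_vectors. norm (x + k) \<le> R} \<subseteq> (\<lambda>k. k - (\<chi> i. of_int \<lfloor>x $ i\<rfloor>)) ` B" for x :: "real ^ 'n"
  proof clarify
    fix k :: "real ^ 'n" assume k: "k \<in> integer_vectors" "norm (x + k) \<le> R"
    define n where "n = ((\<chi> i. of_int \<lfloor>x $ i\<rfloor>) :: real ^ 'n)"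
    have "norm (x - n) \<le> (\<Sum>i\<in>UNIV. \<bar>(x - n) $ i\<bar>)" by (rule norm_le_l1_cart)
    also have "\<dots> \<le> (\<Sum>i\<in>(UNIV::'n set). 1)"
    proof (rule sum_mono)
      show "\<bar>(x - n) $ i\<bar> \<le> 1" for i by (simp add: n_def) linarith
    qed
    finally have "norm (x - n) \<le> real CARD('n)" by simp
    moreover have "norm (k + n) \<le> norm (x + k) + norm (x - n)"
      using norm_triangle_ineq4[of "x + k" "x - n"] by simp
    moreover have "n \<in> integer_vectors" by (simp add: n_def integer_vectors_def)
    ultimately have "k + n \<in> B" using k by (simp add: B_def integer_vectors_add)
    then show "k \<in> (\<lambda>k. k - (\<chi> i. of_int \<lfloor>x $ i\<rfloor>)) ` B"
      by (intro image_eqI[of _ _ "k + n"]) (auto simp: n_def)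
  qed
  then show thesis
    using that[of "card B"] fB by (meson card_image_le card_mono finite_imageI finite_subset le_trans)
qed

section \<open>Test functions and their lattice sums\<close>

lemma bounded_support:
  fixes f :: "'a::real_normed_vector \<Rightarrow> 'b::zero"
  assumes "compact (closure {x. f x \<noteq> 0})"
  obtains R where "\<And>x. f x \<noteq> 0 \<Longrightarrow> norm x \<le> R"
proof -
  obtain R where "\<forall>x\<in>closure {x. f x \<noteq> 0}. norm x \<le> R"
    using compact_imp_bounded[OF assms] unfolding bounded_iff by blast
  then show thesis
    using that closure_subset[of "{x. f x \<noteq> 0}"] by blast
qed

text \<open>Heine-Cantor applies on a ball one unit larger than one containing the support. Of two
  points less than 1 apart, either both lie in the larger ball or \<open>f\<close> vanishes at
  both.\<close>

lemma uniformly_continuous_compact_support: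
  fixes f :: "'a::euclidean_space \<Rightarrow> 'b::real_normed_vector"
  assumes "continuous_on UNIV f" and "compact (closure {x. f x \<noteq> 0})"
  shows "uniformly_continuous_on UNIV f"
proof -
  obtain R where R: "f x \<noteq> 0 \<Longrightarrow> norm x \<le> R" for x
    using bounded_support[OF assms(2)] by blast
  have "uniformly_continuous_on (cball 0 (R + 1)) f"
    using assms(1) by (intro compact_uniformly_continuous) (auto intro: continuous_on_subset)
  show ?thesis unfolding uniformly_continuous_on_def
  proof safe
    fix e :: real assume "e > 0"
    with \<open>uniformly_continuous_on (cball 0 (R + 1)) f\<close> obtain d where d: "d > 0"
      "\<And>x y. x \<in> cball 0 (R + 1) \<Longrightarrow> y \<in> cball 0 (R + 1) \<Longrightarrow> dist y x < d \<Longrightarrow> dist (f y) (f x) < e"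
      by (rule uniformly_continuous_onE) blast
    have "dist (f y) (f x) < e" if "dist y x < min d 1" for x y
    proof (cases "norm x \<le> R + 1 \<and> norm y \<le> R + 1")
      case False
      moreover have "norm x \<le> norm y + 1" "norm y \<le> norm x + 1"
        using that norm_triangle_ineq2[of x y] norm_triangle_ineq2[of y x]
        by (auto simp: dist_norm norm_minus_commute)
      ultimately have "R < norm x" "R < norm y" by auto
      then have "f x = 0" "f y = 0" using R by (meson not_le)+
      with \<open>e > 0\<close> show ?thesis by simp
    qed (use d that in auto)
    with d show "\<exists>d>0. \<forall>x\<in>UNIV. \<forall>y\<in>UNIV. dist y x < d \<longrightarrow> dist (f y) (f x) < e"
      by (intro exI[of _ "min d 1"]) auto
  qed
qed

text \<open>The comb counts each point of the image once, so injectivity is what permits summing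
  over indices. Since \<open>S\<close> may contain indices with zero terms, two integrals can be
  compared over a common \<open>S\<close>.\<close>

lemma integral_dirac_comb_image:
  fixes f :: "'a::topological_space \<Rightarrow> 'b::{banach,second_countable_topology}"
  assumes "f \<in> borel_measurable borel" and "inj_on h I"
    and "finite S" "S \<subseteq> I" "\<And>k. k \<in> I - S \<Longrightarrow> f (h k) = 0"
  shows "(\<integral>t. f t \<partial>dirac_comb (h ` I)) = (\<Sum>k\<in>S. f (h k))"
proof -
  have supp: "{t \<in> h ` I. f t \<noteq> 0} \<subseteq> h ` S" using assms(5) by blast
  have "(\<integral>t. f t \<partial>dirac_comb (h ` I)) = (\<integral>t. f t \<partial>count_space (h ` I))"
    unfolding dirac_comb_def using assms(1) by (subst integral_distr) auto
  also have "\<dots> = (\<Sum>t | t \<in> h ` I \<and> f t \<noteq> 0. f t)"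
    using finite_subset[OF supp] assms(3) by (intro lebesgue_integral_count_space_finite_support) auto
  also have "\<dots> = (\<Sum>t\<in>h ` S. f t)"
    using supp assms(3,4) by (intro sum.mono_neutral_left) auto
  also have "\<dots> = (\<Sum>k\<in>S. f (h k))"
    using assms(2,4) by (subst sum.reindex) (auto intro: inj_on_subset)
  finally show ?thesis .
qed

text \<open>The number of contributing indices is bounded independently of \<open>x\<close> and
  \<open>y\<close>, so a small change in each term suffices. Letting both the base point and the
  displacement vary covers continuity (\<open>a = b\<close>) and almost periods
  (\<open>x = y\<close>) in one estimate.\<close>

lemma lattice_sum_uniform_continuity:
  fixes f :: "real ^ 'n \<Rightarrow> 'b::real_normed_vector"
  assumes "continuous_on UNIV f" and "compact (closure {x. f x \<noteq> 0})" and "e > 0"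
  obtains d where "d > 0"
    and "\<And>x y a b. dist x y \<le> 1 \<Longrightarrow>
      (\<And>k. k \<in> integer_vectors \<Longrightarrow> norm (a k) \<le> C \<and> norm (b k) \<le> C \<and> dist (x + a k) (y + b k) < d) \<Longrightarrow>
      \<exists>S. finite S \<and> S \<subseteq> integer_vectors
        \<and> (\<forall>k\<in>integer_vectors - S. f (x + (k + a k)) = 0 \<and> f (y + (k + b k)) = 0)
        \<and> dist (\<Sum>k\<in>S. f (x + (k + a k))) (\<Sum>k\<in>S. f (y + (k + b k))) < e"
proof -
  obtain R where R: "f x \<noteq> 0 \<Longrightarrow> norm x \<le> R" for x
    using bounded_support[OF assms(2)] by blast
  \<comment> \<open>The radius allows \<open>R\<close> for the support, \<open>C\<close> for the
    displacement and 1 for the distance from \<open>x\<close> to \<open>y\<close>, so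
    \<open>S x\<close> catches the nonzero terms of both sums.\<close>
  define S where "S x = {k \<in> integer_vectors. norm (x + k :: real ^ 'n) \<le> R + C + 1}" for x
  obtain N where fin: "\<And>x. finite (S x)" and N: "\<And>x. card (S x) \<le> N"
    unfolding S_def by (rule integer_vectors_translate_card[where R = "R + C + 1"]) blast
  \<comment> \<open>The \<open>+ 1\<close> avoids division by 0 and keeps
    \<open>real N * e' < e\<close> strict.\<close>
  define e' where "e' = e / (real N + 1)"
  have "e' > 0" using assms(3) by (simp add: e'_def)
  obtain d where d: "d > 0" "\<And>u v. dist u v < d \<Longrightarrow> dist (f u) (f v) < e'"
    using uniformly_continuous_onE[OF uniformly_continuous_compact_support[OF assms(1,2)] \<open>e' > 0\<close>]
    by (metis UNIV_I)
  show thesis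
  proof (rule that[OF d(1)])
    fix x y :: "real ^ 'n" and a b :: "real ^ 'n \<Rightarrow> real ^ 'n"
    assume xy: "dist x y \<le> 1" and ab: "\<And>k. k \<in> integer_vectors \<Longrightarrow>
      norm (a k) \<le> C \<and> norm (b k) \<le> C \<and> dist (x + a k) (y + b k) < d"
    have "f (x + (k + a k)) = 0 \<and> f (y + (k + b k)) = 0" if k: "k \<in> integer_vectors - S x" for k
    proof -
      have big: "norm (x + k) > R + C + 1" using k by (auto simp: S_def)
      have "norm (x + k) \<le> norm (x + (k + a k)) + norm (a k)"
        using norm_triangle_ineq4[of "x + (k + a k)" "a k"] by (simp add: algebra_simps)
      moreover have "norm (x + k) \<le> norm (y + (k + b k)) + norm (b k) + norm (x - y)"
        using norm_triangle_ineq4[of "y + (k + b k)" "b k"] norm_triangle_ineq[of "y + k" "x - y"]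
        by (simp add: algebra_simps)
      moreover have "norm (a k) \<le> C" "norm (b k) \<le> C" "norm (x - y) \<le> 1"
        using ab[of k] k xy by (auto simp: dist_norm)
      ultimately have "R < norm (x + (k + a k))" "R < norm (y + (k + b k))"
        using big by linarith+
      then show ?thesis using R by (meson not_le)
    qed
    moreover have "dist (\<Sum>k\<in>S x. f (x + (k + a k))) (\<Sum>k\<in>S x. f (y + (k + b k))) < e"
    proof -
      have "dist (\<Sum>k\<in>S x. f (x + (k + a k))) (\<Sum>k\<in>S x. f (y + (k + b k)))
          \<le> (\<Sum>k\<in>S x. norm (f (x + (k + a k)) - f (y + (k + b k))))"
        unfolding dist_norm sum_subtractf[symmetric] by (rule norm_sum)
      also have "\<dots> \<le> (\<Sum>k\<in>S x. e')"
      proof (rule sum_mono)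
        fix k assume "k \<in> S x"
        then have "dist (x + a k) (y + b k) < d" using ab by (auto simp: S_def)
        then have "dist (x + (k + a k)) (y + (k + b k)) < d"
          by (simp add: dist_norm algebra_simps)
        then show "norm (f (x + (k + a k)) - f (y + (k + b k))) \<le> e'"
          using d(2) unfolding dist_norm by (meson less_imp_le)
      qed
      also have "\<dots> \<le> real N * e'" using N[of x] \<open>e' > 0\<close> by (simp add: mult_right_mono)
      also have "\<dots> < e" using assms(3) by (simp add: e'_def field_simps)
      finally show ?thesis .
    qed
    ultimately show "\<exists>S. finite S \<and> S \<subseteq> integer_vectors
        \<and> (\<forall>k\<in>integer_vectors - S. f (x + (k + a k)) = 0 \<and> f (y + (k + b k)) = 0)
        \<and> dist (\<Sum>k\<in>S. f (x + (k + a k))) (\<Sum>k\<in>S. f (y + (k + b k))) < e"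
      using fin[of x] by (intro exI[of _ "S x"] conjI ballI) (simp_all add: S_def subset_iff)
  qed
qed

section \<open>Almost periodicity of perturbed integer lattices\<close>

text \<open>Boundedness of \<open>F\<close> gives local finiteness, and injectivity turns integrals
  into sums over lattice indices. The integer almost periods of \<open>F\<close> supplied by
  \<open>ap\<close> then pass to the integral of every test function.\<close>

theorem almost_periodic_set_perturbed_integer_vectors:
  fixes F :: "real ^ 'n \<Rightarrow> real ^ 'n"
  assumes bdd: "\<And>k. k \<in> integer_vectors \<Longrightarrow> norm (F k) \<le> C"
    and inj: "inj_on (\<lambda>k. k + F k) integer_vectors"
    and ap: "\<And>d. d > 0 \<Longrightarrow>
      relatively_dense {\<tau> \<in> integer_vectors. \<forall>k\<in>integer_vectors. dist (F k) (F (k - \<tau>)) < d}"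
  shows "almost_periodic_set ((\<lambda>k. k + F k) ` integer_vectors)"
proof -
  define h where "h k = k + F k" for k
  have inj_h: "inj_on h integer_vectors" using inj by (simp add: h_def[abs_def])
  have fin: "finite (h ` integer_vectors \<inter> K)" if "compact K" for K
  proof -
    obtain R where R: "\<And>x. x \<in> K \<Longrightarrow> norm x \<le> R"
      using compact_imp_bounded[OF \<open>compact K\<close>] unfolding bounded_iff by blast
    have "h ` integer_vectors \<inter> K \<subseteq> h ` {k \<in> integer_vectors. norm k \<le> R + C}"
    proof clarify
      fix k assume k: "k \<in> integer_vectors" "h k \<in> K"
      have "norm k \<le> norm (h k) + norm (F k)"
        using norm_triangle_ineq4[of "h k" "F k"] by (simp add: h_def)
      with k R[of "h k"] bdd[of k] show "h k \<in> h ` {k \<in> integer_vectors. norm k \<le> R + C}"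
        by (intro imageI) simp
    qed
    then show ?thesis by (rule finite_subset) (intro finite_imageI finite_integer_vectors_norm_le)
  qed
  have "emeasure (dirac_comb (h ` integer_vectors)) K < \<infinity>" if "compact K" for K
  proof -
    have "K \<in> sets borel" using compact_imp_closed[OF that] by simp
    then have "emeasure (dirac_comb (h ` integer_vectors)) K
        = emeasure (count_space (h ` integer_vectors)) (h ` integer_vectors \<inter> K)"
      unfolding dirac_comb_def by (subst emeasure_distr) (auto simp: Int_commute)
    also have "\<dots> < \<infinity>" using fin[OF that] by (subst emeasure_count_space_finite) (auto simp: of_nat_less_top)
    finally show ?thesis .
  qed
  moreover have "almost_periodic_fun (\<lambda>x. \<integral>t. \<phi> (x + t) \<partial>dirac_comb (h ` integer_vectors))"
    if \<phi>: "continuous_on UNIV \<phi>" "compact (closure {x. \<phi> x \<noteq> 0})" for \<phi> :: "real ^ 'n \<Rightarrow> complex"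
  proof -
    define g where "g x = (\<integral>t. \<phi> (x + t) \<partial>dirac_comb (h ` integer_vectors))" for x
    have g_eq: "g x = (\<Sum>k\<in>S. \<phi> (x + h k))"
      if "finite S" "S \<subseteq> integer_vectors" "\<And>k. k \<in> integer_vectors - S \<Longrightarrow> \<phi> (x + h k) = 0" for x S
      unfolding g_def
    proof (rule integral_dirac_comb_image)
      have "continuous_on UNIV (\<lambda>t. \<phi> (x + t))"
        by (rule continuous_on_compose2[OF \<phi>(1)]) (auto intro!: continuous_intros)
      then show "(\<lambda>t. \<phi> (x + t)) \<in> borel_measurable borel" by (rule borel_measurable_continuous_onI)
    qed (use that inj_h in auto)
    \<comment> \<open>Both halves are instances of \<open>osc\<close>: first with equal
      displacements at two points, then at one point with \<open>F\<close> against its shift by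
      \<open>\<tau>\<close>.\<close>
    have g_ap: "\<exists>d>0. (\<forall>x y. dist x y < d \<longrightarrow> dist (g x) (g y) < e) \<and>
        (\<forall>\<tau>\<in>integer_vectors. (\<forall>k\<in>integer_vectors. dist (F k) (F (k - \<tau>)) < d) \<longrightarrow>
          (\<forall>x. dist (g x) (g (x + \<tau>)) < e))" if "e > 0" for e
    proof -
      obtain d where d: "d > 0" and osc: "\<And>x y a b. dist x y \<le> 1 \<Longrightarrow>
        (\<And>k. k \<in> integer_vectors \<Longrightarrow> norm (a k) \<le> C \<and> norm (b k) \<le> C \<and> dist (x + a k) (y + b k) < d) \<Longrightarrow>
        \<exists>S. finite S \<and> S \<subseteq> integer_vectors
          \<and> (\<forall>k\<in>integer_vectors - S. \<phi> (x + (k + a k)) = 0 \<and> \<phi> (y + (k + b k)) = 0)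
          \<and> dist (\<Sum>k\<in>S. \<phi> (x + (k + a k))) (\<Sum>k\<in>S. \<phi> (y + (k + b k))) < e"
        by (rule lattice_sum_uniform_continuity[OF \<phi> \<open>e > 0\<close>, where C = C]) blast
      \<comment> \<open>The cap at 1 meets the condition \<open>dist x y \<le> 1\<close> of
        \<open>osc\<close>.\<close>
      have "dist (g x) (g y) < e" if "dist x y < min d 1" for x y
      proof -
        obtain S where S: "finite S" "S \<subseteq> integer_vectors"
          "\<forall>k\<in>integer_vectors - S. \<phi> (x + (k + F k)) = 0 \<and> \<phi> (y + (k + F k)) = 0"
          "dist (\<Sum>k\<in>S. \<phi> (x + (k + F k))) (\<Sum>k\<in>S. \<phi> (y + (k + F k))) < e"
          using osc[of x y F F] bdd \<open>dist x y < min d 1\<close> by auto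
        have "g x = (\<Sum>k\<in>S. \<phi> (x + (k + F k)))" "g y = (\<Sum>k\<in>S. \<phi> (y + (k + F k)))"
          using S(3) by (auto intro!: g_eq[OF S(1,2), unfolded h_def])
        with S(4) show ?thesis by simp
      qed
      moreover have "dist (g x) (g (x + \<tau>)) < e"
        if \<tau>: "\<tau> \<in> integer_vectors" "\<forall>k\<in>integer_vectors. dist (F k) (F (k - \<tau>)) < d" for \<tau> x
      proof -
        obtain S where S: "finite S" "S \<subseteq> integer_vectors"
          "\<forall>k\<in>integer_vectors - S. \<phi> (x + (k + F k)) = 0 \<and> \<phi> (x + (k + F (k - \<tau>))) = 0"
          "dist (\<Sum>k\<in>S. \<phi> (x + (k + F k))) (\<Sum>k\<in>S. \<phi> (x + (k + F (k - \<tau>)))) < e"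
          using osc[of x x F "\<lambda>k. F (k - \<tau>)"] bdd \<tau> integer_vectors_diff[OF _ \<tau>(1)] by auto
        have "g x = (\<Sum>k\<in>S. \<phi> (x + (k + F k)))"
          using S(3) by (auto intro!: g_eq[OF S(1,2), unfolded h_def])
        \<comment> \<open>Replacing \<open>k\<close> by \<open>k - \<tau>\<close> absorbs the
          translation into the lattice and leaves a trace only in the argument of \<open>F\<close>;
          hence the index set is \<open>S\<close> moved by \<open>- \<tau>\<close>.\<close>
        moreover have "g (x + \<tau>) = (\<Sum>k\<in>(\<lambda>k. k - \<tau>) ` S. \<phi> (x + \<tau> + h k))"
        proof (rule g_eq)
          show "\<phi> (x + \<tau> + h k) = 0" if k: "k \<in> integer_vectors - (\<lambda>k. k - \<tau>) ` S" for k
          proof -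
            have "k + \<tau> \<in> integer_vectors" using k \<tau>(1) by (auto intro: integer_vectors_add)
            moreover have "k + \<tau> \<notin> S" using k by (metis DiffE add_diff_cancel_right' image_eqI)
            ultimately have "\<phi> (x + (k + \<tau> + F (k + \<tau> - \<tau>))) = 0" using S(3) by blast
            then show ?thesis by (simp add: h_def algebra_simps)
          qed
        qed (use S(1,2) \<tau>(1) in \<open>auto intro: integer_vectors_diff\<close>)
        moreover have "(\<Sum>k\<in>(\<lambda>k. k - \<tau>) ` S. \<phi> (x + \<tau> + h k)) = (\<Sum>k\<in>S. \<phi> (x + (k + F (k - \<tau>))))"
          by (subst sum.reindex) (auto simp: h_def algebra_simps inj_on_def)
        ultimately show ?thesis using S(4) by simp
      qed
      ultimately show ?thesis using d by (intro exI[of _ "min d 1"]) auto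
    qed
    have "continuous_on UNIV g"
      unfolding continuous_on_iff
    proof (intro ballI allI impI)
      fix x :: "real ^ 'n" and e :: real assume "e > 0"
      from g_ap[OF this] show "\<exists>d>0. \<forall>x'\<in>UNIV. dist x' x < d \<longrightarrow> dist (g x') (g x) < e" by blast
    qed
    moreover have "relatively_dense {\<tau>. (SUP x. ereal (norm (g (x + \<tau>) - g x))) < ereal e}" if "e > 0" for e
    proof -
      \<comment> \<open>Pointwise strict bounds yield only a weak bound on the supremum, so half of
        \<open>e\<close> is kept in reserve.\<close>
      from g_ap[of "e / 2"] that obtain d where d: "d > 0"
        "\<And>\<tau> x. \<tau> \<in> integer_vectors \<Longrightarrow> \<forall>k\<in>integer_vectors. dist (F k) (F (k - \<tau>)) < d \<Longrightarrow>
          dist (g x) (g (x + \<tau>)) < e / 2"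
        by (auto simp del: less_divide_eq_numeral1)
      have "{\<tau> \<in> integer_vectors. \<forall>k\<in>integer_vectors. dist (F k) (F (k - \<tau>)) < d}
          \<subseteq> {\<tau>. (SUP x. ereal (norm (g (x + \<tau>) - g x))) < ereal e}"
      proof clarify
        fix \<tau> assume \<tau>: "\<tau> \<in> integer_vectors" "\<forall>k\<in>integer_vectors. dist (F k) (F (k - \<tau>)) < d"
        have "(SUP x. ereal (norm (g (x + \<tau>) - g x))) \<le> ereal (e / 2)"
          using d(2)[OF \<tau>] by (intro SUP_least) (auto simp: dist_norm norm_minus_commute intro: less_imp_le)
        also have "\<dots> < ereal e" using that by simp
        finally show "(SUP x. ereal (norm (g (x + \<tau>) - g x))) < ereal e" .
      qed
      with ap[OF d(1)] show ?thesis unfolding relatively_dense_def by (meson subsetD)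
    qed
    ultimately show ?thesis unfolding almost_periodic_fun_def g_def by blast
  qed
  moreover have "sets (dirac_comb (h ` integer_vectors)) = sets borel" by (simp add: dirac_comb_def)
  ultimately have "almost_periodic_measure (dirac_comb (h ` integer_vectors))"
    unfolding almost_periodic_measure_def by blast
  with fin have "almost_periodic_set (h ` integer_vectors)"
    by (auto simp: almost_periodic_set_def discrete_set_def)
  then show ?thesis unfolding h_def .
qed

section \<open>Integer almost periods of the sine\<close>

text \<open>By compactness, finitely many \<open>cis j\<close> approximate every
  \<open>cis n\<close> with integer \<open>n\<close>. Subtracting a matching \<open>j\<close> from
  the floor of \<open>x\<close> gives an almost period at bounded distance from
  \<open>x\<close>.\<close>

lemma sin_integer_almost_periods:
  assumes "d > 0"
  obtains M where "\<And>x::real. \<exists>m::int. \<bar>of_int m - x\<bar> \<le> M \<and> (\<forall>t::real. \<bar>sin t - sin (t - of_int m)\<bar> < d)"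
proof -
  define c where "c n = cis (of_int n)" for n :: int
  have "bounded (range c)" unfolding bounded_iff by (auto simp: c_def)
  then have "compact (closure (range c))" by simp
  moreover have "closure (range c) \<subseteq> (\<Union>n\<in>UNIV. ball (c n) d)"
    using closure_approachable[of _ "range c"] assms by fastforce
  ultimately obtain J where J: "finite J" "closure (range c) \<subseteq> (\<Union>n\<in>J. ball (c n) d)"
    by (rule compactE_image[OF _ open_ball])
  \<comment> \<open>The 1 pays for rounding \<open>x\<close> down, and the sum dominates each
    possible \<open>j\<close>.\<close>
  define M where "M = 1 + (\<Sum>j\<in>J. \<bar>of_int j :: real\<bar>)"
  show thesis
  proof (rule that)
    fix x :: real
    obtain j where j: "j \<in> J" "dist (c j) (c \<lfloor>x\<rfloor>) < d"
      using J(2) closure_subset[of "range c"] by fastforce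
    define m where "m = \<lfloor>x\<rfloor> - j"
    have "\<bar>of_int j :: real\<bar> \<le> (\<Sum>j\<in>J. \<bar>of_int j :: real\<bar>)"
      using J(1) j(1) by (intro member_le_sum) auto
    then have "\<bar>of_int m - x\<bar> \<le> M" unfolding m_def M_def of_int_diff by linarith
    moreover have "\<bar>sin t - sin (t - of_int m)\<bar> < d" for t :: real
    proof -
      \<comment> \<open>The first factor has modulus 1, so the estimate is uniform in
        \<open>t\<close>.\<close>
      have "cis t - cis (t - of_int m) = cis (t - of_int \<lfloor>x\<rfloor>) * (c \<lfloor>x\<rfloor> - c j)"
        by (simp add: c_def m_def right_diff_distrib cis_mult algebra_simps)
      then have "norm (cis t - cis (t - of_int m)) < d"
        using j(2) by (simp add: norm_mult dist_norm norm_minus_commute)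
      moreover have "\<bar>sin t - sin (t - of_int m)\<bar> \<le> norm (cis t - cis (t - of_int m))"
        using abs_Im_le_cmod[of "cis t - cis (t - of_int m)"] by simp
      ultimately show ?thesis by simp
    qed
    ultimately show "\<exists>m::int. \<bar>of_int m - x\<bar> \<le> M \<and> (\<forall>t::real. \<bar>sin t - sin (t - of_int m)\<bar> < d)"
      by blast
  qed
qed

section \<open>Exclusion and existence of periods\<close>

text \<open>Each perturbation is at most 1/5 in size, so every jump \<open>g n - n\<close> is an
  integer within 2/5 of \<open>t\<close>. Two such integers differ by at most 4/5, so the jump is
  constant and the difference of sines is too.\<close>

lemma sin_perturbed_integers_period_eq_0:
  fixes t :: real
  assumes "\<And>n::int. \<exists>n'::int. of_int n + sin (of_int n) / 5 + t = of_int n' + sin (of_int n') / 5"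
  shows "t = 0"
proof -
  from assms obtain g :: "int \<Rightarrow> int"
    where g: "of_int n + sin (of_int n) / 5 + t = of_int (g n) + sin (of_int (g n)) / 5" for n
    by metis
  define d where "d = g 0"
  have "g n = n + d" for n
  proof -
    have bound: "\<bar>t - of_int (g k - k)\<bar> \<le> 2 / 5" for k
      using g[of k] sin_le_one[of "of_int k"] sin_ge_minus_one[of "of_int k"]
        sin_le_one[of "of_int (g k)"] sin_ge_minus_one[of "of_int (g k)"]
      unfolding of_int_diff by linarith
    have "\<bar>of_int (g n - n) - of_int (g 0 - 0)\<bar> < (1::real)"
      using bound[of n] bound[of 0] by linarith
    then show ?thesis unfolding d_def by linarith
  qed
  \<comment> \<open>The constant \<open>5 * (t - of_int d)\<close> and the shift \<open>d\<close>
    must both vanish, hence so does \<open>t\<close>.\<close>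
  then have *: "sin (of_int (n + d)) - sin (of_int n) = 5 * (t - of_int d)" for n
    using g[of n] by simp
  from sin_int_period_eq_0[OF *] show ?thesis by simp
qed

text \<open>Any lattice vector translates \<open>L\<close>, and with it the sum, onto
  itself.\<close>

lemma discrete_lattice_sum_period:
  fixes L :: "(real ^ 'n) set"
  assumes "discrete_lattice L"
  obtains \<tau> where "\<tau> \<noteq> 0" and "is_period {l + e | l e. l \<in> L \<and> e \<in> E} \<tau>"
proof -
  obtain \<Gamma> :: "real ^ 'n ^ 'n" where \<Gamma>: "invertible \<Gamma>" "L = {k v* \<Gamma> | k. k \<in> integer_vectors}"
    using assms by (auto simp: discrete_lattice_def)
  \<comment> \<open>Here \<open>1\<close> is the all-ones vector, an integer vector whose image
    under the invertible matrix is nonzero.\<close>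
  define \<tau> where "\<tau> = 1 v* \<Gamma>"
  have one: "(1 :: real ^ 'n) \<in> integer_vectors" by (simp add: integer_vectors_def)
  have "\<tau> \<noteq> 0"
  proof
    assume "\<tau> = 0"
    obtain \<Gamma>' where "\<Gamma> ** \<Gamma>' = mat 1" using \<Gamma>(1) by (auto simp: invertible_def)
    then have "(1 :: real ^ 'n) = \<tau> v* \<Gamma>'" by (simp add: \<tau>_def vector_matrix_mul_assoc)
    with \<open>\<tau> = 0\<close> show False by simp
  qed
  have "l + \<tau> \<in> L" if "l \<in> L" for l
    using that one integer_vectors_add by (force simp: \<Gamma>(2) \<tau>_def vector_matrix_left_distrib[symmetric])
  moreover have "l - \<tau> \<in> L" if "l \<in> L" for l
    using that one integer_vectors_diff by (force simp: \<Gamma>(2) \<tau>_def vector_matrix_mult_diff_distrib[symmetric])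
  moreover have "l + e + \<tau> = (l + \<tau>) + e" "l + e = ((l - \<tau>) + e) + \<tau>" for l e by simp_all
  ultimately have "is_period {l + e | l e. l \<in> L \<and> e \<in> E} \<tau>"
    unfolding is_period_def image_def by blast
  with \<open>\<tau> \<noteq> 0\<close> show thesis by (rule that)
qed

section \<open>Perturbation by the sines of the coordinates\<close>

theorem mainTheorem2:
  fixes F :: "real ^ 'p \<Rightarrow> real ^ 'p" and A :: "(real ^ 'p) set"
  assumes F: "F = (\<lambda>x. (1 / 5) *\<^sub>R (\<chi> i. sin (x $ i)))"
    and A: "A = {k + F k | k. k \<in> integer_vectors}"
  shows "almost_periodic_set A
    \<and> \<not> (\<exists>\<tau>. \<tau> \<noteq> 0 \<and> is_period A \<tau>)
    \<and> \<not> (\<exists>L E. discrete_lattice L \<and> finite E \<and> A = {l + e | l e. l \<in> L \<and> e \<in> E})"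
proof -
  have F_nth: "F x $ i = sin (x $ i) / 5" for x i by (simp add: F)
  have A_image: "A = (\<lambda>k. k + F k) ` integer_vectors" by (auto simp: A)
  have "almost_periodic_set A"
    unfolding A_image
  proof (rule almost_periodic_set_perturbed_integer_vectors)
    show "norm (F k) \<le> real CARD('p)" for k
    proof -
      have "norm (F k) \<le> (\<Sum>i\<in>UNIV. \<bar>F k $ i\<bar>)" by (rule norm_le_l1_cart)
      also have "\<dots> \<le> (\<Sum>i\<in>(UNIV :: 'p set). 1)"
      proof (rule sum_mono)
        show "\<bar>F k $ i\<bar> \<le> 1" for i using abs_sin_le_one[of "k $ i"] unfolding F_nth by linarith
      qed
      finally show ?thesis by simp
    qed
    show "inj_on (\<lambda>k. k + F k) integer_vectors"
    proof (rule inj_onI)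
      fix k l assume kl: "k \<in> integer_vectors" "l \<in> integer_vectors" "k + F k = l + F l"
      have "k $ i = l $ i" for i
      proof -
        obtain m n :: int where mn: "k $ i = of_int m" "l $ i = of_int n"
          using kl(1,2) unfolding integer_vectors_def by (metis Ints_cases mem_Collect_eq)
        have "k $ i + F k $ i = l $ i + F l $ i" using kl(3) by (metis vector_add_component)
        then have "of_int m + sin (of_int m) / 5 = of_int n + sin (of_int n) / (5::real)"
          by (simp add: F_nth mn)
        \<comment> \<open>The two displacements differ by at most 2/5, too little to bring distinct
          integers together.\<close>
        then have "\<bar>of_int m - of_int n\<bar> < (1::real)"
          using sin_le_one[of "of_int m"] sin_ge_minus_one[of "of_int m"]
            sin_le_one[of "of_int n"] sin_ge_minus_one[of "of_int n"] by linarith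
        then have "m = n" by linarith
        with mn show ?thesis by simp
      qed
      then show "k = l" by (simp add: vec_eq_iff)
    qed
    fix d :: real assume "d > 0"
    \<comment> \<open>Distances are estimated by the sum of \<open>CARD('p)\<close> coordinate
      differences, each allowed an equal share of \<open>d\<close>.\<close>
    define d' where "d' = d / real CARD('p)"
    have "d' > 0" using \<open>d > 0\<close> by (simp add: d'_def)
    then obtain M where M: "\<And>x::real. \<exists>m::int. \<bar>of_int m - x\<bar> \<le> M
        \<and> (\<forall>t::real. \<bar>sin t - sin (t - of_int m)\<bar> < d')"
      by (rule sin_integer_almost_periods) blast
    then obtain m :: "real \<Rightarrow> int" where m: "\<bar>of_int (m x) - x\<bar> \<le> M"
      "\<bar>sin t - sin (t - of_int (m x))\<bar> < d'" for x t :: real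
      by metis
    show "relatively_dense {\<tau> \<in> integer_vectors. \<forall>k\<in>integer_vectors. dist (F k) (F (k - \<tau>)) < d}"
      unfolding relatively_dense_def
    \<comment> \<open>Each coordinate is within \<open>M\<close>; the extra 1 accommodates the open
      ball.\<close>
    proof (intro exI[of _ "real CARD('p) * M + 1"] allI)
      fix x :: "real ^ 'p"
      \<comment> \<open>Each coordinate of \<open>x\<close> is replaced by a nearby integer almost
        period of the sine.\<close>
      define \<tau> where "\<tau> = ((\<chi> i. of_int (m (x $ i))) :: real ^ 'p)"
      have "\<tau> \<in> integer_vectors" by (simp add: \<tau>_def integer_vectors_def)
      moreover have "dist (F k) (F (k - \<tau>)) < d" for k
      proof -
        have "dist (F k) (F (k - \<tau>)) \<le> (\<Sum>i\<in>UNIV. \<bar>(F k - F (k - \<tau>)) $ i\<bar>)"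
          unfolding dist_norm by (rule norm_le_l1_cart)
        also have "\<dots> < (\<Sum>i\<in>(UNIV :: 'p set). d')"
        proof (rule sum_strict_mono)
          fix i
          have "(F k - F (k - \<tau>)) $ i = sin (k $ i) / 5 - sin (k $ i - of_int (m (x $ i))) / 5"
            by (simp add: F_nth \<tau>_def)
          with m(2)[of "k $ i" "x $ i"] show "\<bar>(F k - F (k - \<tau>)) $ i\<bar> < d'" by linarith
        qed auto
        also have "\<dots> = d" by (simp add: d'_def)
        finally show ?thesis .
      qed
      moreover have "\<tau> \<in> ball x (real CARD('p) * M + 1)"
      proof -
        have "dist x \<tau> \<le> (\<Sum>i\<in>UNIV. \<bar>(x - \<tau>) $ i\<bar>)"
          unfolding dist_norm by (rule norm_le_l1_cart)
        also have "\<dots> \<le> (\<Sum>i\<in>(UNIV :: 'p set). M)"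
          by (rule sum_mono) (use m(1) in \<open>simp add: \<tau>_def abs_minus_commute\<close>)
        finally show ?thesis by simp
      qed
      ultimately show "\<exists>\<tau>\<in>{\<tau> \<in> integer_vectors. \<forall>k\<in>integer_vectors. dist (F k) (F (k - \<tau>)) < d}.
          \<tau> \<in> ball x (real CARD('p) * M + 1)"
        by blast
    qed
  qed
  moreover have no_period: "\<tau> = 0" if "is_period A \<tau>" for \<tau>
  proof -
    have "\<tau> $ i = 0" for i
    proof (rule sin_perturbed_integers_period_eq_0)
      fix n :: int
      \<comment> \<open>A lattice point with coordinate \<open>i\<close> equal to \<open>n\<close>
        reduces the question to one dimension.\<close>
      define k where "k = ((\<chi> i. of_int n) :: real ^ 'p)"
      have "k + F k \<in> A" unfolding A_image by (intro imageI) (simp add: k_def integer_vectors_def)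
      then have "k + F k + \<tau> \<in> A" using that unfolding is_period_def by blast
      then obtain l where l: "l \<in> integer_vectors" "k + F k + \<tau> = l + F l" by (auto simp: A)
      obtain n' :: int where n': "l $ i = of_int n'"
        using l(1) unfolding integer_vectors_def by (metis Ints_cases mem_Collect_eq)
      have "(k + F k + \<tau>) $ i = (l + F l) $ i" using l(2) by simp
      then have "of_int n + sin (of_int n) / 5 + \<tau> $ i = of_int n' + sin (of_int n') / 5"
        by (simp add: F_nth n') (simp add: k_def)
      then show "\<exists>n'::int. of_int n + sin (of_int n) / 5 + \<tau> $ i = of_int n' + sin (of_int n') / 5" ..
    qed
    then show ?thesis by (simp add: vec_eq_iff)
  qed
  moreover have "A \<noteq> {l + e | l e. l \<in> L \<and> e \<in> E}" if "discrete_lattice L" for L E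
    using discrete_lattice_sum_period[OF that, of E] no_period by metis
  ultimately show ?thesis by blast
qed

end
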